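(* Let $(\Omega,\mathcal F,\mu)$ be a probability space and let $(\mathcal E,\mathcal D(\mathcal E))$ be a conservative symmetric Dirichlet form on $L^2(\mu)$. Let $q\in[1,2]$ and let $C$ be a real constant such that $$\Psi_q(f)\le C\,\mathcal E(f,f)\qquad\text{for every non-negative } f\in\mathcal D(\mathcal E).$$ Then, for every $1\le p\le q$, with the same constant $C$, $$\Psi_p(f)\le C\,\mathcal E(f,f)\qquad\text{for every non-negative } f\in\mathcal D(\mathcal E).$$
   Context: A symmetric Dirichlet form $(\mathcal E,\mathcal D(\mathcal E))$ on $L^2(\mu)$ is called conservative if $1\in\mathcal D(\mathcal E)$ and $\mathcal E(1,1)=0$. For a non-negative $f\in L^2(\mu)$ and $1\le p<2$, with $\mu(g):=\int g\,d\mu$, $$\Psi_p(f):=\frac{\mu(f^2)-\mu(f^p)^{2/p}}{2-p},$$ and $$\Psi_2(f):=\tfrac12\mathrm{Ent}_\mu(f^2),\qquad \mathrm{Ent}_\mu(f^2)=\mu(f^2\log f^2)-\mu(f^2)\log\mu(f^2)\in[0,\infty],$$ with the convention $0\log 0=0$. *)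

theory Defs
  imports "HOL-Probability.Probability"
begin

text \<open>
  Elements of \<open>L\<^sup>2(M)\<close> are represented by square-integrable functions. The passage to classes
  modulo equality almost everywhere is expressed by requiring the domain of a form to be saturated
  under, and the form to respect, equality almost everywhere.
\<close>

definition L2_fun :: "'a measure \<Rightarrow> ('a \<Rightarrow> real) set" where
  "L2_fun M = {f \<in> borel_measurable M. integrable M (\<lambda>x. (f x)\<^sup>2)}"

text \<open>
  A densely defined, non-negative definite, symmetric bilinear form \<open>E\<close> with domain \<open>D\<close> that is
  closed (\<open>D\<close> is complete for \<open>E\<^sub>1(f,f) = E(f,f) + \<integral>f\<^sup>2\<close>) and Markovian (the unit contraction
  operates). Values of \<open>E\<close> outside \<open>D \<times> D\<close> are irrelevant.
\<close>

locale symmetric_dirichlet_form =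
  fixes M :: "'a measure"
    and D :: "('a \<Rightarrow> real) set"
    and E :: "('a \<Rightarrow> real) \<Rightarrow> ('a \<Rightarrow> real) \<Rightarrow> real"
  assumes dom_L2: "D \<subseteq> L2_fun M"
    and dom_AE: "\<And>f g. f \<in> D \<Longrightarrow> g \<in> borel_measurable M \<Longrightarrow> (AE x in M. f x = g x) \<Longrightarrow> g \<in> D"
    and form_AE: "\<And>f g h. f \<in> D \<Longrightarrow> g \<in> D \<Longrightarrow> h \<in> D \<Longrightarrow> (AE x in M. f x = g x) \<Longrightarrow> E f h = E g h"
    and dom_zero: "(\<lambda>x. 0) \<in> D"
    and dom_add: "\<And>f g. f \<in> D \<Longrightarrow> g \<in> D \<Longrightarrow> (\<lambda>x. f x + g x) \<in> D"
    and dom_scale: "\<And>c f. f \<in> D \<Longrightarrow> (\<lambda>x. c * f x) \<in> D"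
    and dom_dense: "\<And>f \<epsilon>. f \<in> L2_fun M \<Longrightarrow> 0 < \<epsilon> \<Longrightarrow> \<exists>g\<in>D. (\<integral>x. (f x - g x)\<^sup>2 \<partial>M) < \<epsilon>"
    and form_sym: "\<And>f g. f \<in> D \<Longrightarrow> g \<in> D \<Longrightarrow> E f g = E g f"
    and form_add: "\<And>f g h. f \<in> D \<Longrightarrow> g \<in> D \<Longrightarrow> h \<in> D \<Longrightarrow> E (\<lambda>x. f x + g x) h = E f h + E g h"
    and form_scale: "\<And>c f h. f \<in> D \<Longrightarrow> h \<in> D \<Longrightarrow> E (\<lambda>x. c * f x) h = c * E f h"
    and form_nonneg: "\<And>f. f \<in> D \<Longrightarrow> 0 \<le> E f f"
    and form_closed:
      "\<And>u :: nat \<Rightarrow> 'a \<Rightarrow> real.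
        (\<And>n. u n \<in> D) \<Longrightarrow>
        (\<And>\<epsilon>. 0 < \<epsilon> \<Longrightarrow> \<exists>N. \<forall>m\<ge>N. \<forall>n\<ge>N.
            E (\<lambda>x. u m x - u n x) (\<lambda>x. u m x - u n x) + (\<integral>x. (u m x - u n x)\<^sup>2 \<partial>M) < \<epsilon>) \<Longrightarrow>
        \<exists>v\<in>D. (\<lambda>n. E (\<lambda>x. u n x - v x) (\<lambda>x. u n x - v x) + (\<integral>x. (u n x - v x)\<^sup>2 \<partial>M)) \<longlonglongrightarrow> 0"
    and unit_contraction_dom: "\<And>f. f \<in> D \<Longrightarrow> (\<lambda>x. min (max (f x) 0) 1) \<in> D"
    and unit_contraction_le:
      "\<And>f. f \<in> D \<Longrightarrow> E (\<lambda>x. min (max (f x) 0) 1) (\<lambda>x. min (max (f x) 0) 1) \<le> E f f"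

definition conservative_form ::
  "('a \<Rightarrow> real) set \<Rightarrow> (('a \<Rightarrow> real) \<Rightarrow> ('a \<Rightarrow> real) \<Rightarrow> real) \<Rightarrow> bool" where
  "conservative_form D E \<longleftrightarrow> (\<lambda>x. 1) \<in> D \<and> E (\<lambda>x. 1) (\<lambda>x. 1) = 0"

text \<open>
  Extended integral, positive part minus negative part (\<^const>\<open>ennreal\<close> sends negative reals to
  \<open>0\<close>); meaningful when one of the two parts is finite. The Bochner integral is not used here
  because it is \<open>0\<close>, rather than \<open>\<infinity>\<close>, on functions that are not integrable.
\<close>

definition ext_integral :: "'a measure \<Rightarrow> ('a \<Rightarrow> real) \<Rightarrow> ereal" where
  "ext_integral M g =
     enn2ereal (\<integral>\<^sup>+x. ennreal (g x) \<partial>M) - enn2ereal (\<integral>\<^sup>+x. ennreal (- g x) \<partial>M)"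

text \<open>
  For integrable \<open>g \<ge> 0\<close> on a probability space the negative part of \<open>g log g\<close> is bounded, so the
  extended integral is in \<open>(-\<infinity>, \<infinity>]\<close>. The convention \<open>0 log 0 = 0\<close> holds by \<open>0 * ln 0 = 0\<close>.
\<close>

definition Ent :: "'a measure \<Rightarrow> ('a \<Rightarrow> real) \<Rightarrow> ereal" where
  "Ent M g = ext_integral M (\<lambda>x. g x * ln (g x))
     - ereal ((\<integral>x. g x \<partial>M) * ln (\<integral>x. g x \<partial>M))"

definition Psi :: "'a measure \<Rightarrow> real \<Rightarrow> ('a \<Rightarrow> real) \<Rightarrow> ereal" where
  "Psi M p f =
     (if p = 2 then ereal (1 / 2) * Ent M (\<lambda>x. (f x)\<^sup>2)
      else ereal (((\<integral>x. (f x)\<^sup>2 \<partial>M) - (\<integral>x. f x powr p \<partial>M) powr (2 / p)) / (2 - p)))"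

end

theory Submission
  imports Defs
begin

text \<open>
  The form does not see constants: conservativity and Cauchy--Schwarz give
  \<open>E (f + c) (f + c) = E f f\<close>, so the inequality with exponent \<open>q\<close> may be applied to \<open>\<tau> f + c\<close> for
  all \<open>\<tau>, c \<ge> 0\<close>. After rescaling, it remains to bound \<open>\<Psi>\<^sub>p(f)\<close> by \<open>\<Psi>\<^sub>q(f + c)\<close> for a well
  chosen shift, and this is a statement about the measure alone.

  For \<open>p < 2\<close> the tangent of the convex function \<open>y \<mapsto> y powr (2 / p)\<close> at \<open>a powr p\<close> turns \<open>\<Psi>\<^sub>p\<close>
  into a minimum of linear functionals:
  \<open>\<Psi>\<^sub>p(f) = min\<^sub>a \<integral> \<phi>\<^sub>p(f, a)\<close>, where
  \<open>\<phi>\<^sub>p(x, a) = (x\<^sup>2 - a\<^sup>2 - (2 / p) a powr (2 - p) (x powr p - a powr p)) / (2 - p)\<close>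
  and the minimum is attained at \<open>a = (\<integral> f powr p) powr (1 / p)\<close>; for \<open>p = 2\<close> one takes
  the limit of \<open>\<phi>\<^sub>p\<close>. As a function of \<open>x\<close>, \<open>\<phi>\<^sub>p(x, a)\<close> vanishes to first order at \<open>x = a\<close>, has
  second derivative \<open>2\<close> there, and has third derivative \<open>2 (p - 1) / a\<close> there. Kernels with
  exponents \<open>p\<close> and \<open>q\<close> can therefore be compared only if they are centred at points proportional
  to \<open>p - 1\<close> and \<open>q - 1\<close>. By homogeneity the centres may be taken equal to \<open>p - 1\<close> and \<open>q - 1\<close>,
  which makes the shift \<open>c = q - p\<close>. With this choice the third derivatives are ordered on each
  side of the centre, and Taylor's theorem gives the pointwise inequality
  \<open>\<phi>\<^sub>p(x, p - 1) \<le> \<phi>\<^sub>q(x + (q - p), q - 1)\<close> for \<open>x \<ge> 0\<close> (lemma \<open>Beckner_kernel_mono\<close>).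

  Integrating it bounds \<open>\<Psi>\<^sub>p(f)\<close> by \<open>\<integral> \<phi>\<^sub>q(f + (q - p), q - 1)\<close>, and this integral is
  \<open>\<Psi>\<^sub>q(f + (q - p))\<close> as soon as the \<open>L\<^sup>q\<close> norm of \<open>f + (q - p)\<close> is \<open>q - 1\<close>
  (lemma \<open>Psi_le_of_Psi_shift_le\<close>). The norm of \<open>\<tau> f + (q - p)\<close> increases continuously
  from \<open>q - p < q - 1\<close> to infinity with \<open>\<tau>\<close>, so a suitable multiple of \<open>f\<close> has this property
  (lemma \<open>normalizing_scale_exists\<close>), and both sides of the desired inequality scale
  with \<open>\<tau>\<^sup>2\<close>. The exponent \<open>p = 1\<close>, whose kernel would be centred at \<open>0\<close>, is reached by letting
  \<open>p\<close> decrease to \<open>1\<close>.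
\<close>

section \<open>Kernels representing the Beckner functionals\<close>

text \<open>
  The kernel \<open>\<phi>\<^sub>q(x, a)\<close> at \<open>a = q - 1\<close>. The case \<open>q = 2\<close> is the limit of the other one
  as \<open>q\<close> tends to \<open>2\<close>.
\<close>

definition Beckner_kernel :: "real \<Rightarrow> real \<Rightarrow> real" where
  "Beckner_kernel q x =
     (if q = 2 then x\<^sup>2 * ln x - (x\<^sup>2 - 1) / 2
      else (x\<^sup>2 - (q - 1)\<^sup>2 - (2 / q) * (q - 1) powr (2 - q) * (x powr q - (q - 1) powr q)) / (2 - q))"

text \<open>
  First and second derivative of the kernel. They are kept as separate functions because the
  third derivative, unlike these, has one formula for \<open>q = 2\<close> and \<open>q < 2\<close>.
\<close>

definition Beckner_kernel' :: "real \<Rightarrow> real \<Rightarrow> real" where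
  "Beckner_kernel' q x =
     (if q = 2 then 2 * x * ln x
      else 2 * (x - (q - 1) powr (2 - q) * x powr (q - 1)) / (2 - q))"

definition Beckner_kernel'' :: "real \<Rightarrow> real \<Rightarrow> real" where
  "Beckner_kernel'' q x =
     (if q = 2 then 2 * ln x + 2
      else 2 * (1 - (q - 1) powr (3 - q) * x powr (q - 2)) / (2 - q))"

lemma Beckner_kernel_deriv:
  assumes "1 < q" "q \<le> 2" "0 < x"
  shows "(Beckner_kernel q has_real_derivative Beckner_kernel' q x) (at x)"
proof (cases "q = 2")
  case True
  have "((\<lambda>x. x\<^sup>2 * ln x - (x\<^sup>2 - 1) / 2) has_real_derivative 2 * x * ln x) (at x)"
    using \<open>0 < x\<close> by (auto intro!: derivative_eq_intros simp: power2_eq_square field_simps)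
  then show ?thesis using True by (simp add: Beckner_kernel_def [abs_def] Beckner_kernel'_def)
next
  case False
  have "((\<lambda>x. (x\<^sup>2 - (q - 1)\<^sup>2 - (2 / q) * (q - 1) powr (2 - q) * (x powr q - (q - 1) powr q)) / (2 - q))
     has_real_derivative (2 * x - (2 / q) * (q - 1) powr (2 - q) * (q * x powr (q - 1))) / (2 - q)) (at x)"
    using assms False
    by (auto intro!: derivative_eq_intros has_real_derivative_powr)
  moreover have "(2 * x - (2 / q) * (q - 1) powr (2 - q) * (q * x powr (q - 1))) / (2 - q)
     = 2 * (x - (q - 1) powr (2 - q) * x powr (q - 1)) / (2 - q)"
    using assms by (simp add: algebra_simps)
  ultimately show ?thesis
    using False by (simp add: Beckner_kernel_def [abs_def] Beckner_kernel'_def)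
qed

lemma Beckner_kernel'_deriv:
  assumes "1 < q" "q \<le> 2" "0 < x"
  shows "(Beckner_kernel' q has_real_derivative Beckner_kernel'' q x) (at x)"
proof (cases "q = 2")
  case True
  have "((\<lambda>x. 2 * x * ln x) has_real_derivative 2 * ln x + 2) (at x)"
    using \<open>0 < x\<close> by (auto intro!: derivative_eq_intros)
  then show ?thesis using True by (simp add: Beckner_kernel'_def [abs_def] Beckner_kernel''_def)
next
  case False
  have "((\<lambda>x. 2 * (x - (q - 1) powr (2 - q) * x powr (q - 1)) / (2 - q)) has_real_derivative
      2 * (1 - (q - 1) powr (2 - q) * ((q - 1) * x powr (q - 1 - 1))) / (2 - q)) (at x)"
    using assms False
    by (auto intro!: derivative_eq_intros has_real_derivative_powr)
  moreover have "(q - 1) powr (2 - q) * (q - 1) = (q - 1) powr (3 - q)"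
    using assms powr_add[of "q - 1" "2 - q" 1] by simp
  ultimately show ?thesis
    using False by (simp add: Beckner_kernel'_def [abs_def] Beckner_kernel''_def flip: mult.assoc)
qed

lemma Beckner_kernel''_deriv:
  assumes "1 < q" "q \<le> 2" "0 < x"
  shows "(Beckner_kernel'' q has_real_derivative 2 * (x / (q - 1)) powr (q - 3)) (at x)"
proof (cases "q = 2")
  case True
  have "((\<lambda>x. 2 * ln x + 2) has_real_derivative 2 / x) (at x)"
    using \<open>0 < x\<close> by (auto intro!: derivative_eq_intros)
  moreover have "x powr -1 = 1 / x" using \<open>0 < x\<close> by (simp add: powr_minus_divide)
  ultimately show ?thesis using True by (simp add: Beckner_kernel''_def [abs_def])
next
  case False
  have "((\<lambda>x. 2 * (1 - (q - 1) powr (3 - q) * x powr (q - 2)) / (2 - q)) has_real_derivative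
      2 * (- ((q - 1) powr (3 - q) * ((q - 2) * x powr (q - 2 - 1)))) / (2 - q)) (at x)"
    using assms False
    by (auto intro!: derivative_eq_intros has_real_derivative_powr)
  moreover have "(x / (q - 1)) powr (q - 3) = (q - 1) powr (3 - q) * x powr (q - 3)"
    using assms powr_minus_divide[of "q - 1" "q - 3"] by (simp add: powr_divide)
  then have "2 * (- ((q - 1) powr (3 - q) * ((q - 2) * x powr (q - 2 - 1)))) / (2 - q)
     = 2 * (x / (q - 1)) powr (q - 3)"
    using False by (simp add: divide_simps) (simp add: algebra_simps)
  ultimately show ?thesis
    using False by (simp add: Beckner_kernel''_def [abs_def])
qed

section \<open>Comparison of the kernels\<close>

text \<open>
  The values do not depend on \<open>q\<close>, so that the difference of two kernels with aligned centres
  vanishes there to second order.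
\<close>

lemma Beckner_kernel_at_center:
  assumes "1 < q" "q \<le> 2"
  shows "Beckner_kernel q (q - 1) = 0" "Beckner_kernel' q (q - 1) = 0" "Beckner_kernel'' q (q - 1) = 2"
proof -
  have 1: "(q - 1) powr (2 - q) * (q - 1) powr (q - 1) = q - 1"
    using assms by (simp flip: powr_add)
  have 2: "(q - 1) powr (3 - q) * (q - 1) powr (q - 2) = q - 1"
    using assms by (simp flip: powr_add)
  show "Beckner_kernel q (q - 1) = 0" "Beckner_kernel' q (q - 1) = 0" "Beckner_kernel'' q (q - 1) = 2"
    using assms by (auto simp: Beckner_kernel_def Beckner_kernel'_def Beckner_kernel''_def 1 2 divide_simps)
qed

text \<open>
  For \<open>h > 0\<close> both the base \<open>1 + h / (q - 1) \<ge> 1\<close> shrinks and the negative exponent \<open>q - 3\<close> grows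
  when \<open>q\<close> increases in the powers below: the first raises the value since the exponent is negative,
  the second since the base is at least \<open>1\<close>. For \<open>h < 0\<close> the base is at most \<open>1\<close> and grows, and
  both effects are reversed.
\<close>

lemma kernel_third_derivative_diff_sign:
  fixes p q h :: real
  assumes "1 < p" "p \<le> q" "q \<le> 2" "1 - p < h"
  shows "0 \<le> ((1 + h / (q - 1)) powr (q - 3) - (1 + h / (p - 1)) powr (p - 3)) * h"
proof (cases "0 \<le> h")
  case True
  have "h / (q - 1) \<le> h / (p - 1)" using assms True by (intro divide_left_mono) auto
  then have "(1 + h / (p - 1)) powr (p - 3) \<le> (1 + h / (q - 1)) powr (p - 3)"
    using assms True by (intro powr_mono2') (auto simp: add_pos_nonneg)
  also have "\<dots> \<le> (1 + h / (q - 1)) powr (q - 3)"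
    using assms True by (intro powr_mono) auto
  finally show ?thesis using True by simp
next
  case False
  have "h / (p - 1) \<le> h / (q - 1)" using assms False by (intro divide_left_mono_neg) auto
  moreover have "0 < 1 + h / (p - 1)" using assms by (simp add: field_simps)
  moreover have "1 + h / (q - 1) \<le> 1" using assms False by (simp add: divide_nonpos_pos)
  ultimately have "(1 + h / (q - 1)) powr (q - 3) \<le> (1 + h / (q - 1)) powr (p - 3)"
      "(1 + h / (q - 1)) powr (p - 3) \<le> (1 + h / (p - 1)) powr (p - 3)"
    using assms by (auto intro!: powr_mono' powr_mono2')
  then show ?thesis using False by (intro mult_nonpos_nonpos) auto
qed

text \<open>
  Taylor's theorem for the difference of the kernels, expanded at the common centre \<open>x = p - 1\<close>:
  only the cubic remainder survives, and its coefficient has the sign of \<open>x - (p - 1)\<close>.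
\<close>

lemma Beckner_kernel_mono_pos:
  fixes p q x :: real
  assumes pq: "1 < p" "p \<le> q" "q \<le> 2" and "0 < x"
  shows "Beckner_kernel p x \<le> Beckner_kernel q (x + (q - p))"
proof (cases "x = p - 1")
  case True
  then show ?thesis using Beckner_kernel_at_center[of p] Beckner_kernel_at_center[of q] assms by simp
next
  case False
  \<comment> \<open>\<open>d n\<close> is the \<open>n\<close>-th derivative of the difference.\<close>
  define d where "d = (\<lambda>n::nat. \<lambda>y.
    if n = 0 then Beckner_kernel q (y + (q - p)) - Beckner_kernel p y
    else if n = 1 then Beckner_kernel' q (y + (q - p)) - Beckner_kernel' p y
    else if n = 2 then Beckner_kernel'' q (y + (q - p)) - Beckner_kernel'' p y
    else 2 * ((y + (q - p)) / (q - 1)) powr (q - 3) - 2 * (y / (p - 1)) powr (p - 3))"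
  have deriv: "\<forall>m t. m < 3 \<and> min x (p - 1) \<le> t \<and> t \<le> max x (p - 1) \<longrightarrow> DERIV (d m) t :> d (Suc m) t"
  proof (intro allI impI)
    fix m :: nat and t assume mt: "m < 3 \<and> min x (p - 1) \<le> t \<and> t \<le> max x (p - 1)"
    then have t: "0 < t" "0 < t + (q - p)" using assms by auto
    have "m = 0 \<or> m = 1 \<or> m = 2" using mt by auto
    then show "DERIV (d m) t :> d (Suc m) t"
      using t pq Beckner_kernel_deriv[of q "t + (q - p)"] Beckner_kernel'_deriv[of q "t + (q - p)"]
        Beckner_kernel''_deriv[of q "t + (q - p)"] Beckner_kernel_deriv[of p t]
        Beckner_kernel'_deriv[of p t] Beckner_kernel''_deriv[of p t]
      by (auto simp: d_def numeral_2_eq_2 DERIV_shift intro!: DERIV_diff)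
  qed
  have "\<exists>t. (if x < p - 1 then x < t \<and> t < p - 1 else p - 1 < t \<and> t < x) \<and>
    d 0 x = (\<Sum>m<3. (d m (p - 1) / fact m) * (x - (p - 1)) ^ m) + (d 3 t / fact 3) * (x - (p - 1)) ^ 3"
    by (rule Taylor[OF _ refl deriv]) (use False in auto)
  then obtain t where t: "if x < p - 1 then x < t \<and> t < p - 1 else p - 1 < t \<and> t < x"
    and eq: "d 0 x = (\<Sum>m<3. (d m (p - 1) / fact m) * (x - (p - 1)) ^ m) + (d 3 t / fact 3) * (x - (p - 1)) ^ 3"
    by blast
  have eq': "d 0 x = (d 3 t / fact 3) * (x - (p - 1)) ^ 3"
    using Beckner_kernel_at_center[of p] Beckner_kernel_at_center[of q] pq
    by (subst eq) (simp add: d_def lessThan_nat_numeral lessThan_Suc)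
  define h where "h = t - (p - 1)"
  have h: "1 - p < h" "h \<noteq> 0" "0 \<le> h * (x - (p - 1))"
    using t False \<open>0 < x\<close> pq by (auto simp: h_def zero_le_mult_iff split: if_splits)
  have "d 3 t = 2 * ((1 + h / (q - 1)) powr (q - 3) - (1 + h / (p - 1)) powr (p - 3))"
  proof -
    have "(t + (q - p)) / (q - 1) = 1 + h / (q - 1)" "t / (p - 1) = 1 + h / (p - 1)"
      using pq by (auto simp: h_def field_simps)
    then show ?thesis by (simp add: d_def)
  qed
  moreover have "0 \<le> 2 * (((1 + h / (q - 1)) powr (q - 3) - (1 + h / (p - 1)) powr (p - 3)) * h)"
    by (rule mult_nonneg_nonneg[OF _ kernel_third_derivative_diff_sign[OF pq h(1)]]) simp
  ultimately have d3: "0 \<le> d 3 t * h" by (simp only: mult.assoc)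
  have "0 \<le> d 3 t * (x - (p - 1)) ^ 3"
  proof (cases "0 < h")
    case True
    then have "0 \<le> d 3 t" "0 \<le> x - (p - 1)" using d3 h(3) by (simp_all add: zero_le_mult_iff)
    then show ?thesis by (intro mult_nonneg_nonneg zero_le_power)
  next
    case neg: False
    then have "d 3 t \<le> 0" "x - (p - 1) \<le> 0" using d3 h(2,3) by (auto simp: zero_le_mult_iff)
    then show ?thesis by (intro mult_nonpos_nonpos) (auto simp: power_le_zero_eq)
  qed
  then have "0 \<le> d 0 x" unfolding eq' by (simp add: divide_nonneg_pos)
  then show ?thesis by (simp add: d_def)
qed

text \<open>
  The kernel is not differentiable enough at \<open>0\<close> for Taylor's theorem, but it is continuous there,
  and functions in the domain of the form may vanish on a set of positive measure.
\<close>

lemma Beckner_kernel_mono: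
  fixes p q x :: real
  assumes pq: "1 < p" "p < q" "q \<le> 2" and "0 \<le> x"
  shows "Beckner_kernel p x \<le> Beckner_kernel q (x + (q - p))"
proof (cases "x = 0")
  case True
  have "continuous (at_right 0) (Beckner_kernel p)"
    unfolding Beckner_kernel_def continuous_within
    using pq by (auto intro!: tendsto_eq_intros simp: eventually_at_filter)
  then have 1: "((\<lambda>y. Beckner_kernel p y) \<longlongrightarrow> Beckner_kernel p 0) (at_right 0)"
    by (simp add: continuous_within)
  have "isCont (Beckner_kernel q) (0 + (q - p))"
    using Beckner_kernel_deriv[of q "0 + (q - p)"] pq DERIV_isCont by auto
  moreover have "((\<lambda>y. y + (q - p)) \<longlongrightarrow> 0 + (q - p)) (at_right 0)"
    by (intro tendsto_intros)
  ultimately have 2: "((\<lambda>y. Beckner_kernel q (y + (q - p))) \<longlongrightarrow> Beckner_kernel q (0 + (q - p))) (at_right 0)"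
    by (rule isCont_tendsto_compose)
  have "Beckner_kernel p 0 \<le> Beckner_kernel q (0 + (q - p))"
    by (rule tendsto_le[OF _ 2 1])
       (use pq Beckner_kernel_mono_pos in \<open>auto simp: eventually_at_filter\<close>)
  then show ?thesis using True by simp
qed (use assms Beckner_kernel_mono_pos in auto)

section \<open>Integrability and continuity of power integrals\<close>

lemma powr_ge_tangent_at_1:
  fixes y \<alpha> :: real
  assumes "0 \<le> y" "1 \<le> \<alpha>"
  shows "1 + \<alpha> * (y - 1) \<le> y powr \<alpha>"
proof (cases "y = 0")
  case False
  have "((\<lambda>y. y powr \<alpha>) has_real_derivative \<alpha> * 1 powr (\<alpha> - 1)) (at 1 within {0<..})"
    by (rule has_field_derivative_at_within[OF has_real_derivative_powr]) simp
  then have "\<alpha> * 1 powr (\<alpha> - 1) * (y - 1) \<le> y powr \<alpha> - 1 powr \<alpha>"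
    using assms False
    by (intro convex_on_imp_above_tangent[where A = "{0<..}" and f = "\<lambda>y. y powr \<alpha>"] powr_convex)
      (auto simp: interior_open)
  then show ?thesis by simp
qed (use assms in auto)

lemma powr_le_1_plus_square:
  fixes x p :: real
  assumes "0 \<le> x" "0 \<le> p" "p \<le> 2"
  shows "x powr p \<le> 1 + x\<^sup>2"
proof (cases "x \<le> 1")
  case True
  then have "x powr p \<le> 1" using assms by (simp add: powr_le1)
  then show ?thesis by (simp add: add_increasing2)
next
  case False
  then have "x powr p \<le> x powr 2" using assms by (intro powr_mono) auto
  then show ?thesis using assms by simp
qed

lemma (in prob_space) L2_fun_affine:
  assumes "f \<in> L2_fun M"
  shows "(\<lambda>x. \<tau> * f x + c) \<in> L2_fun M"
proof -
  have [measurable]: "f \<in> borel_measurable M" and f2: "integrable M (\<lambda>x. (f x)\<^sup>2)"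
    using assms by (auto simp: L2_fun_def)
  have "integrable M f" by (rule square_integrable_imp_integrable[OF _ f2]) fact
  then have "integrable M (\<lambda>x. \<tau>\<^sup>2 * (f x)\<^sup>2 + 2 * \<tau> * c * f x + c\<^sup>2)"
    using f2 by auto
  moreover have "(\<tau> * f x + c)\<^sup>2 = \<tau>\<^sup>2 * (f x)\<^sup>2 + 2 * \<tau> * c * f x + c\<^sup>2" for x
    by (simp add: power2_eq_square algebra_simps)
  ultimately show ?thesis by (simp add: L2_fun_def)
qed

lemma (in prob_space) integrable_powr_L2_fun:
  assumes f: "f \<in> L2_fun M" "AE x in M. 0 \<le> f x" and p: "0 \<le> p" "p \<le> 2"
  shows "integrable M (\<lambda>x. f x powr p)"
proof (rule Bochner_Integration.integrable_bound)
  show "integrable M (\<lambda>x. 1 + (f x)\<^sup>2)" using f by (auto simp: L2_fun_def)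
  show "(\<lambda>x. f x powr p) \<in> borel_measurable M" using f by (auto simp: L2_fun_def)
  show "AE x in M. norm (f x powr p) \<le> norm (1 + (f x)\<^sup>2)"
    using f(2) by eventually_elim (use powr_le_1_plus_square p in auto)
qed

text \<open>
  Dominated convergence in the scale and in the exponent at once: varying the scale is what the
  intermediate value theorem needs, and varying the exponent gives the limit \<open>p \<rightarrow> 1\<close>.
\<close>

lemma (in prob_space) tendsto_integral_affine_powr:
  fixes r t :: "nat \<Rightarrow> real"
  assumes f: "f \<in> L2_fun M" "AE x in M. 0 \<le> f x"
    and c: "0 \<le> c"
    and t: "t \<longlonglongrightarrow> \<tau>" "\<And>n. 0 \<le> t n" "\<And>n. t n \<le> T"
    and r: "r \<longlonglongrightarrow> p" "\<And>n. 0 \<le> r n" "\<And>n. r n \<le> 2" "0 < p"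
  shows "(\<lambda>n. \<integral>x. (t n * f x + c) powr r n \<partial>M) \<longlonglongrightarrow> (\<integral>x. (\<tau> * f x + c) powr p \<partial>M)"
proof (rule integral_dominated_convergence)
  have [measurable]: "f \<in> borel_measurable M" using f by (auto simp: L2_fun_def)
  show "(\<lambda>x. (\<tau> * f x + c) powr p) \<in> borel_measurable M"
    "\<And>n. (\<lambda>x. (t n * f x + c) powr r n) \<in> borel_measurable M" by measurable
  show "integrable M (\<lambda>x. 1 + (T * f x + c)\<^sup>2)"
    using L2_fun_affine[OF f(1), of T c] by (auto simp: L2_fun_def)
  show "AE x in M. (\<lambda>n. (t n * f x + c) powr r n) \<longlonglongrightarrow> (\<tau> * f x + c) powr p"
    using f(2)
    by eventually_elim (use t r c in \<open>auto intro!: tendsto_powr2 tendsto_intros\<close>)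
  show "AE x in M. norm ((t n * f x + c) powr r n) \<le> 1 + (T * f x + c)\<^sup>2" for n
    using f(2)
  proof eventually_elim
    case (elim x)
    then have 0: "0 \<le> t n * f x + c" "t n * f x \<le> T * f x" using t(2,3)[of n] c by (auto intro: mult_right_mono)
    then have "(t n * f x + c) powr r n \<le> 1 + (t n * f x + c)\<^sup>2"
      using r by (intro powr_le_1_plus_square) auto
    also have "(t n * f x + c)\<^sup>2 \<le> (T * f x + c)\<^sup>2" using 0 by (intro power_mono) auto
    finally show ?case by simp
  qed
qed

section \<open>The Beckner functionals as integrals of kernels\<close>

lemma (in prob_space) integral_kernel_lt_2:
  assumes f: "f \<in> L2_fun M" "AE x in M. 0 \<le> f x" and p: "1 < p" "p < 2"
  shows "integrable M (\<lambda>x. Beckner_kernel p (f x))"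
    and "(\<integral>x. Beckner_kernel p (f x) \<partial>M) =
      ((\<integral>x. (f x)\<^sup>2 \<partial>M) - (p - 1)\<^sup>2
        - (2 / p) * (p - 1) powr (2 - p) * ((\<integral>x. f x powr p \<partial>M) - (p - 1) powr p)) / (2 - p)"
proof -
  have f2: "integrable M (\<lambda>x. (f x)\<^sup>2)" using f by (auto simp: L2_fun_def)
  have fp: "integrable M (\<lambda>x. f x powr p)" using f p by (intro integrable_powr_L2_fun) auto
  show "integrable M (\<lambda>x. Beckner_kernel p (f x))"
    using f2 fp p unfolding Beckner_kernel_def by auto
  show "(\<integral>x. Beckner_kernel p (f x) \<partial>M) =
      ((\<integral>x. (f x)\<^sup>2 \<partial>M) - (p - 1)\<^sup>2
        - (2 / p) * (p - 1) powr (2 - p) * ((\<integral>x. f x powr p \<partial>M) - (p - 1) powr p)) / (2 - p)"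
    using f2 fp p unfolding Beckner_kernel_def by (simp add: prob_space)
qed

text \<open>
  The tangent of \<open>y \<mapsto> y powr (2 / p)\<close> at \<open>(p - 1) powr p\<close> lies below the graph, and the kernel is
  \<open>\<Psi>\<^sub>p\<close> with the power replaced by this tangent. In the proof the inequality is divided
  by \<open>(p - 1)\<^sup>2\<close>, so that the point of tangency becomes \<open>1\<close>.
\<close>

lemma (in prob_space) Psi_le_integral_kernel:
  assumes f: "f \<in> L2_fun M" "AE x in M. 0 \<le> f x" and p: "1 < p" "p < 2"
  shows "Psi M p f \<le> ereal (\<integral>x. Beckner_kernel p (f x) \<partial>M)"
proof -
  define m where "m = (\<integral>x. f x powr p \<partial>M)"
  have m: "0 \<le> m" unfolding m_def by simp
  have "1 + (2 / p) * (m / (p - 1) powr p - 1) \<le> (m / (p - 1) powr p) powr (2 / p)"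
    using p m by (intro powr_ge_tangent_at_1) auto
  also have "\<dots> = m powr (2 / p) / (p - 1)\<^sup>2"
    using p m by (simp add: powr_divide powr_powr)
  finally have "(p - 1)\<^sup>2 * (1 + (2 / p) * (m / (p - 1) powr p - 1)) \<le> m powr (2 / p)"
    using p by (simp add: pos_le_divide_eq mult.commute)
  moreover have "(p - 1)\<^sup>2 = (p - 1) powr (2 - p) * (p - 1) powr p"
    using p by (simp flip: powr_add)
  then have "(p - 1)\<^sup>2 * (m / (p - 1) powr p - 1) = (p - 1) powr (2 - p) * (m - (p - 1) powr p)"
    using p by (simp add: field_simps)
  then have "(p - 1)\<^sup>2 * (1 + (2 / p) * (m / (p - 1) powr p - 1))
     = (p - 1)\<^sup>2 + (2 / p) * (p - 1) powr (2 - p) * (m - (p - 1) powr p)"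
    by (simp only: distrib_left mult.assoc mult.left_commute[of "(p - 1)\<^sup>2" "2 / p"] mult_1_right)
  ultimately show ?thesis
    using p integral_kernel_lt_2(2)[OF f p]
    by (simp add: Psi_def m_def divide_right_mono)
qed

lemma mult_ln_ge_minus_1:
  fixes y :: real
  assumes "0 \<le> y"
  shows "- 1 \<le> y * ln y"
proof (cases "y = 0")
  case False
  then have "ln (1 / y) \<le> 1 / y - 1" using assms by (intro ln_le_minus_one) auto
  then have "1 - 1 / y \<le> ln y" using assms False by (simp add: ln_div)
  then have "y * (1 - 1 / y) \<le> y * ln y" using assms by (intro mult_left_mono)
  then show ?thesis using False assms by (simp add: right_diff_distrib)
qed auto

text \<open>
  An upper bound on the entropy is what makes \<open>g\<^sup>2 ln (g\<^sup>2)\<close> integrable: its negative part is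
  bounded, so only the positive part could have an infinite integral.
\<close>

lemma (in prob_space) finite_ext_integral_bounded_below:
  assumes g[measurable]: "g \<in> borel_measurable M" and below: "AE x in M. - B \<le> g x"
    and fin: "ext_integral M g < \<infinity>"
  shows "integrable M g" and "ext_integral M g = ereal (\<integral>x. g x \<partial>M)"
proof -
  have "(\<integral>\<^sup>+x. ennreal (- g x) \<partial>M) \<le> (\<integral>\<^sup>+x. ennreal B \<partial>M)"
    using below by (intro nn_integral_mono_AE) (auto elim!: eventually_mono intro!: ennreal_leI)
  also have "\<dots> = ennreal B" by (simp add: emeasure_space_1)
  finally have neg: "(\<integral>\<^sup>+x. ennreal (- g x) \<partial>M) \<noteq> \<infinity>"
    by (metis ennreal_neq_top infinity_ennreal_def neq_top_trans)
  have pos: "(\<integral>\<^sup>+x. ennreal (g x) \<partial>M) \<noteq> \<infinity>"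
    using fin neg unfolding ext_integral_def
    by (cases "\<integral>\<^sup>+x. ennreal (- g x) \<partial>M") auto
  show int: "integrable M g"
    using neg pos by (simp add: real_integrable_def)
  show "ext_integral M g = ereal (\<integral>x. g x \<partial>M)"
    unfolding ext_integral_def real_lebesgue_integral_def[OF int] using neg pos
    by (cases "\<integral>\<^sup>+x. ennreal (- g x) \<partial>M"; cases "\<integral>\<^sup>+x. ennreal (g x) \<partial>M") auto
qed

text \<open>
  If the \<open>L\<^sup>q\<close> norm of \<open>g\<close> is exactly the centre \<open>q - 1\<close>, the tangent touches the graph at the
  relevant point, so that \<open>\<Psi>\<^sub>q(g)\<close> equals the integral of the kernel. For \<open>q = 2\<close> the
  normalization makes the term \<open>\<mu>(g\<^sup>2) log \<mu>(g\<^sup>2)\<close> of the entropy vanish.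
\<close>

lemma (in prob_space) integral_kernel_le_of_Psi_le:
  assumes g: "g \<in> L2_fun M" "AE x in M. 0 \<le> g x" and q: "1 < q" "q \<le> 2"
    and norm: "(\<integral>x. g x powr q \<partial>M) = (q - 1) powr q"
    and le: "Psi M q g \<le> ereal K"
  shows "integrable M (\<lambda>x. Beckner_kernel q (g x))"
    and "(\<integral>x. Beckner_kernel q (g x) \<partial>M) \<le> K"
proof -
  have [measurable]: "g \<in> borel_measurable M" and g2: "integrable M (\<lambda>x. (g x)\<^sup>2)"
    using g by (auto simp: L2_fun_def)
  have "integrable M (\<lambda>x. Beckner_kernel q (g x)) \<and> (\<integral>x. Beckner_kernel q (g x) \<partial>M) \<le> K"
  proof (cases "q = 2")
    case False
    then have "((q - 1) powr q) powr (2 / q) = (q - 1)\<^sup>2"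
      using q by (simp add: powr_powr)
    then show ?thesis
      using False q le norm integral_kernel_lt_2[OF g, of q] by (simp add: Psi_def)
  next
    case True
    have "(\<integral>x. (g x)\<^sup>2 \<partial>M) = (\<integral>x. g x powr q \<partial>M)"
      using g(2) True by (intro integral_cong_AE) (auto elim!: eventually_mono)
    then have norm2: "(\<integral>x. (g x)\<^sup>2 \<partial>M) = 1" using norm True by simp
    define u where "u = (\<lambda>x. (g x)\<^sup>2 * ln ((g x)\<^sup>2))"
    have [measurable]: "u \<in> borel_measurable M" unfolding u_def by measurable
    have le': "ereal (1 / 2) * ext_integral M u \<le> ereal K"
      using le True norm2 by (simp add: Psi_def Ent_def u_def zero_ereal_def[symmetric])
    then have fin: "ext_integral M u < \<infinity>"
      by (cases "ext_integral M u") auto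
    have "AE x in M. - 1 \<le> u x" unfolding u_def by (intro AE_I2 mult_ln_ge_minus_1) auto
    note u = finite_ext_integral_bounded_below[OF _ this fin]
    have intu: "integrable M u" and "ext_integral M u = ereal (\<integral>x. u x \<partial>M)"
      by (rule u; measurable)+
    then have uK: "(\<integral>x. u x \<partial>M) / 2 \<le> K" using le' by simp
    have eq: "AE x in M. u x / 2 - ((g x)\<^sup>2 - 1) / 2 = Beckner_kernel q (g x)"
      using g(2)
    proof eventually_elim
      case (elim x)
      then show ?case using True
        by (cases "g x = 0") (auto simp: u_def Beckner_kernel_def ln_realpow)
    qed
    have meas: "(\<lambda>x. Beckner_kernel q (g x)) \<in> borel_measurable M"
      using True unfolding Beckner_kernel_def by simp
    have int: "integrable M (\<lambda>x. u x / 2 - ((g x)\<^sup>2 - 1) / 2)" using intu g2 by auto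
    have "integrable M (\<lambda>x. Beckner_kernel q (g x))"
      by (rule integrable_cong_AE_imp[OF int meas eq])
    moreover have "(\<integral>x. Beckner_kernel q (g x) \<partial>M) = (\<integral>x. u x / 2 - ((g x)\<^sup>2 - 1) / 2 \<partial>M)"
      using eq by (intro integral_cong_AE meas borel_measurable_integrable[OF int]) (auto elim!: eventually_mono)
    moreover have "\<dots> = (\<integral>x. u x \<partial>M) / 2"
      using intu g2 norm2 by (simp add: prob_space)
    ultimately show ?thesis using uK by simp
  qed
  then show "integrable M (\<lambda>x. Beckner_kernel q (g x))"
    and "(\<integral>x. Beckner_kernel q (g x) \<partial>M) \<le> K" by auto
qed

section \<open>Shifting and scaling\<close>

text \<open>
  The pointwise comparison of the kernels, integrated. The normalization identifies the integral
  of the larger kernel with \<open>\<Psi>\<^sub>q\<close>; for the smaller one the tangent inequality suffices.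
\<close>

lemma (in prob_space) Psi_le_of_Psi_shift_le:
  assumes f: "f \<in> L2_fun M" "AE x in M. 0 \<le> f x" and pq: "1 < p" "p < q" "q \<le> 2"
    and norm: "(\<integral>x. (f x + (q - p)) powr q \<partial>M) = (q - 1) powr q"
    and le: "Psi M q (\<lambda>x. f x + (q - p)) \<le> ereal K"
  shows "Psi M p f \<le> ereal K"
proof -
  have g: "(\<lambda>x. f x + (q - p)) \<in> L2_fun M" "AE x in M. 0 \<le> f x + (q - p)"
    using L2_fun_affine[OF f(1), of 1 "q - p"] f(2) pq by (auto elim!: eventually_mono)
  have "1 < q" using pq by simp
  note k = integral_kernel_le_of_Psi_le[OF g this \<open>q \<le> 2\<close> norm le]
  have "p < 2" using pq by simp
  have "Psi M p f \<le> ereal (\<integral>x. Beckner_kernel p (f x) \<partial>M)"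
    by (rule Psi_le_integral_kernel[OF f \<open>1 < p\<close> \<open>p < 2\<close>])
  also have "(\<integral>x. Beckner_kernel p (f x) \<partial>M) \<le> (\<integral>x. Beckner_kernel q (f x + (q - p)) \<partial>M)"
  proof (rule integral_mono_AE[OF integral_kernel_lt_2(1)[OF f \<open>1 < p\<close> \<open>p < 2\<close>] k(1)])
    show "AE x in M. Beckner_kernel p (f x) \<le> Beckner_kernel q (f x + (q - p))"
      using f(2) by eventually_elim (rule Beckner_kernel_mono[OF pq])
  qed
  also have "\<dots> \<le> K" by (rule k(2))
  finally show ?thesis by simp
qed

text \<open>
  The intermediate value theorem for the \<open>q\<close>-th moment of \<open>\<tau> f + c\<close>: it is \<open>c powr q\<close> at \<open>\<tau> = 0\<close>
  and at least \<open>\<tau> powr q\<close> times the \<open>q\<close>-th moment of \<open>f\<close>, which is positive as \<open>f\<close> is not null.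
\<close>

lemma (in prob_space) normalizing_scale_exists:
  assumes f: "f \<in> L2_fun M" "AE x in M. 0 \<le> f x" "\<not> (AE x in M. f x = 0)"
    and q: "1 \<le> q" "q \<le> 2" and cb: "0 \<le> c" "c < b"
  shows "\<exists>\<tau>>0. (\<integral>x. (\<tau> * f x + c) powr q \<partial>M) = b powr q"
proof -
  define N where "N = (\<lambda>\<tau>. \<integral>x. (\<tau> * f x + c) powr q \<partial>M)"
  have [measurable]: "f \<in> borel_measurable M" using f by (auto simp: L2_fun_def)
  define m where "m = (\<integral>x. f x powr q \<partial>M)"
  have fq: "integrable M (\<lambda>x. f x powr q)" using f q by (intro integrable_powr_L2_fun) auto
  have "m \<noteq> 0"
    using f(3) integral_nonneg_eq_0_iff_AE[OF fq] by (auto simp: m_def)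
  moreover have "0 \<le> m" unfolding m_def by simp
  ultimately have m: "0 < m" by simp
  \<comment> \<open>At the scale \<open>T\<close> the function \<open>T f\<close> alone has \<open>q\<close>-th moment \<open>b powr q\<close>.\<close>
  define T where "T = b / m powr (1 / q)"
  have T: "0 \<le> T" using m cb by (simp add: T_def)
  have "continuous_on {0..T} N"
  proof (rule continuous_on_sequentiallyI)
    fix u a assume "\<forall>n. u n \<in> {0..T}" "a \<in> {0..T}" "u \<longlonglongrightarrow> a"
    then show "(\<lambda>n. N (u n)) \<longlonglongrightarrow> N a"
      unfolding N_def using f q cb by (intro tendsto_integral_affine_powr[where T = T]) auto
  qed
  moreover have N0: "N 0 < b powr q"
    using q cb by (simp add: N_def prob_space powr_less_mono2)
  moreover have "b powr q \<le> N T"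
  proof -
    have "b powr q = T powr q * m"
      using q m cb by (simp add: T_def powr_divide powr_powr)
    also have "\<dots> = (\<integral>x. (T * f x) powr q \<partial>M)"
      by (simp add: m_def powr_mult)
    also have "\<dots> \<le> N T"
      unfolding N_def
    proof (rule integral_mono_AE)
      show "integrable M (\<lambda>x. (T * f x) powr q)" using fq by (simp add: powr_mult)
      show "integrable M (\<lambda>x. (T * f x + c) powr q)"
        using L2_fun_affine[OF f(1), of T c] f(2) T q cb
        by (intro integrable_powr_L2_fun) (auto elim!: eventually_mono)
      show "AE x in M. (T * f x) powr q \<le> (T * f x + c) powr q"
        using f(2) by eventually_elim (use T q cb in \<open>auto intro!: powr_mono2\<close>)
    qed
    finally show ?thesis .
  qed
  ultimately obtain \<tau> where "0 \<le> \<tau>" "N \<tau> = b powr q"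
    using IVT'[of N 0 "b powr q" T] T by auto
  moreover have "\<tau> \<noteq> 0" using \<open>N \<tau> = b powr q\<close> N0 by auto
  ultimately show ?thesis unfolding N_def by (intro exI[of _ \<tau>]) auto
qed

lemma Psi_scale:
  assumes "0 < \<tau>" "1 \<le> p" "p < 2"
  shows "Psi M p (\<lambda>x. \<tau> * f x) = ereal (\<tau>\<^sup>2) * Psi M p f"
proof -
  have "(\<integral>x. (\<tau> * f x) powr p \<partial>M) powr (2 / p) = (\<tau> powr p) powr (2 / p) * (\<integral>x. f x powr p \<partial>M) powr (2 / p)"
    by (simp only: powr_mult integral_mult_right_zero)
  also have "(\<tau> powr p) powr (2 / p) = \<tau>\<^sup>2" using assms by (simp add: powr_powr)
  finally have "(\<integral>x. (\<tau> * f x)\<^sup>2 \<partial>M) - (\<integral>x. (\<tau> * f x) powr p \<partial>M) powr (2 / p)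
    = \<tau>\<^sup>2 * ((\<integral>x. (f x)\<^sup>2 \<partial>M) - (\<integral>x. f x powr p \<partial>M) powr (2 / p))"
    by (simp only: power_mult_distrib integral_mult_right_zero right_diff_distrib)
  then show ?thesis using assms by (simp add: Psi_def)
qed

lemma (in prob_space) Psi_zero:
  assumes "AE x in M. f x = 0" "f \<in> borel_measurable M" "p \<noteq> 2"
  shows "Psi M p f = 0"
proof -
  have "(\<integral>x. (f x)\<^sup>2 \<partial>M) = (\<integral>x. 0 \<partial>M)" "(\<integral>x. f x powr p \<partial>M) = (\<integral>x. 0 \<partial>M)"
    using assms by (intro integral_cong_AE; auto elim!: eventually_mono)+
  then show ?thesis using assms by (simp add: Psi_def zero_ereal_def)
qed

lemma (in prob_space) Psi_1_le_of_Psi_le: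
  assumes f: "f \<in> L2_fun M" "AE x in M. 0 \<le> f x" and q: "1 < q" "q \<le> 2"
    and le: "\<And>p. 1 < p \<Longrightarrow> p < q \<Longrightarrow> Psi M p f \<le> ereal K"
  shows "Psi M 1 f \<le> ereal K"
proof -
  \<comment> \<open>Any sequence in the open interval from \<open>1\<close> to \<open>q\<close> that tends to \<open>1\<close>; the \<open>2\<close> keeps it below \<open>q\<close>.\<close>
  define r where "r = (\<lambda>n. 1 + (q - 1) / real (n + 2))"
  have r: "1 < r n" "r n < q" for n
  proof -
    show "1 < r n" using q by (simp add: r_def)
    have "(q - 1) * 1 < (q - 1) * real (n + 2)" using q by (intro mult_strict_left_mono) auto
    then have "(q - 1) / real (n + 2) < q - 1" by (subst pos_divide_less_eq) auto
    then show "r n < q" by (simp add: r_def)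
  qed
  have lim: "r \<longlonglongrightarrow> 1"
    proof -
    have "(\<lambda>n. 1 + (q - 1) / real (n + 2)) \<longlonglongrightarrow> 1 + 0"
      by (intro tendsto_add tendsto_const LIMSEQ_ignore_initial_segment lim_const_over_n)
    then show ?thesis by (simp add: r_def)
  qed
  have "(\<lambda>n. \<integral>x. (1 * f x + 0) powr r n \<partial>M) \<longlonglongrightarrow> (\<integral>x. (1 * f x + 0) powr 1 \<partial>M)"
  proof (rule tendsto_integral_affine_powr[OF f, where T = 1])
    show "0 \<le> r n" "r n \<le> 2" for n using r[of n] q by auto
  qed (use lim in auto)
  then have I: "(\<lambda>n. \<integral>x. f x powr r n \<partial>M) \<longlonglongrightarrow> (\<integral>x. f x powr 1 \<partial>M)" by simp
  have "(\<lambda>n. ((\<integral>x. (f x)\<^sup>2 \<partial>M) - (\<integral>x. f x powr r n \<partial>M) powr (2 / r n)) / (2 - r n))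
     \<longlonglongrightarrow> ((\<integral>x. (f x)\<^sup>2 \<partial>M) - (\<integral>x. f x powr 1 \<partial>M) powr (2 / 1)) / (2 - 1)"
    by (intro tendsto_intros I lim tendsto_powr2) auto
  moreover have "((\<integral>x. (f x)\<^sup>2 \<partial>M) - (\<integral>x. f x powr r n \<partial>M) powr (2 / r n)) / (2 - r n) \<le> K" for n
  proof -
    have "r n \<noteq> 2" using r[of n] q by simp
    then show ?thesis using le[OF r(1)[of n] r(2)[of n]] by (simp add: Psi_def)
  qed
  ultimately have "((\<integral>x. (f x)\<^sup>2 \<partial>M) - (\<integral>x. f x powr 1 \<partial>M) powr (2 / 1)) / (2 - 1) \<le> K"
    using LIMSEQ_le_const2 by blast
  then show ?thesis by (simp add: Psi_def)
qed

section \<open>Conservative forms\<close>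

context symmetric_dirichlet_form
begin

lemma form_of_AE_zero:
  assumes "f \<in> D" "AE x in M. f x = 0"
  shows "E f f = 0"
proof -
  have "E f f = E (\<lambda>x. 0 * f x) f"
    using assms dom_scale[of f 0] by (intro form_AE) (auto elim!: eventually_mono)
  then show ?thesis using assms form_scale[of f f 0] by simp
qed

lemma form_scale_diag:
  assumes "f \<in> D"
  shows "E (\<lambda>x. c * f x) (\<lambda>x. c * f x) = c\<^sup>2 * E f f"
  using assms dom_scale[of f c] form_scale[of f "\<lambda>x. c * f x" c] form_scale[of f f c]
    form_sym[of f "\<lambda>x. c * f x"] by (simp add: power2_eq_square)

text \<open>
  The constant \<open>1\<close> is a null vector of a non-negative form, hence orthogonal to the whole domain:
  otherwise \<open>E (f + c) (f + c)\<close>, which is affine in \<open>c\<close>, would become negative.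
\<close>

lemma form_add_const:
  assumes cons: "conservative_form D E" and f: "f \<in> D"
  shows "(\<lambda>x. f x + c) \<in> D" and "E (\<lambda>x. f x + c) (\<lambda>x. f x + c) = E f f"
proof -
  have one: "(\<lambda>x. 1) \<in> D" "E (\<lambda>x. 1) (\<lambda>x. 1) = 0"
    using cons by (auto simp: conservative_form_def)
  have dom: "(\<lambda>x. f x + c) \<in> D" for c
    using dom_add[OF f dom_scale[OF one(1), of c]] by simp
  then show "(\<lambda>x. f x + c) \<in> D" .
  have form1: "E (\<lambda>x. f x + c) h = E f h + c * E (\<lambda>x. 1) h" if "h \<in> D" for c h
    using form_add[OF f dom_scale[OF one(1), of c] that] form_scale[OF one(1) that, of c] by simp
  have expand: "E (\<lambda>x. f x + c) (\<lambda>x. f x + c) = E f f + 2 * c * E f (\<lambda>x. 1)" for c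
    using form1[OF f, of c] form1[OF one(1), of c] form1[OF dom, of c c] one(2)
      form_sym[OF f dom[of c]] form_sym[OF one(1) dom[of c]] form_sym[OF one(1) f]
    by simp
  have "E f (\<lambda>x. 1) = 0"
  proof (rule ccontr)
    assume ne: "E f (\<lambda>x. 1) \<noteq> 0"
    \<comment> \<open>The constant is the one at which the affine function of \<open>c\<close> takes the value \<open>-1\<close>.\<close>
    have "0 \<le> E f f + 2 * (- (E f f + 1) / (2 * E f (\<lambda>x. 1))) * E f (\<lambda>x. 1)"
      using form_nonneg[OF dom, of "- (E f f + 1) / (2 * E f (\<lambda>x. 1))"] unfolding expand .
    moreover have "2 * (- (E f f + 1) / (2 * E f (\<lambda>x. 1))) * E f (\<lambda>x. 1) = - (E f f + 1)"
      using ne by simp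
    ultimately show False by linarith
  qed
  then show "E (\<lambda>x. f x + c) (\<lambda>x. f x + c) = E f f" using expand by simp
qed

end

section \<open>Monotonicity of the Beckner inequalities\<close>

text \<open>
  Functions that vanish almost everywhere are treated apart, since no multiple of them
  can be normalized; both sides are then \<open>0\<close>, whatever the sign of \<open>C\<close>.
\<close>

lemma Beckner_inequality_downward:
  assumes "prob_space M" and "symmetric_dirichlet_form M D E" and cons: "conservative_form D E"
    and pq: "1 < p" "p < q" "q \<le> 2"
    and Beckner: "\<And>f. f \<in> D \<Longrightarrow> (AE x in M. 0 \<le> f x) \<Longrightarrow> Psi M q f \<le> ereal (C * E f f)"
    and f: "f \<in> D" "AE x in M. 0 \<le> f x"
  shows "Psi M p f \<le> ereal (C * E f f)"
proof -
  interpret prob_space M by fact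
  interpret symmetric_dirichlet_form M D E by fact
  have L2: "f \<in> L2_fun M" using dom_L2 f by auto
  show ?thesis
  proof (cases "AE x in M. f x = 0")
    case True
    then show ?thesis
      using Psi_zero[OF True, of p] form_of_AE_zero[OF f(1) True] L2 pq by (simp add: L2_fun_def)
  next
    case False
    obtain \<tau> where \<tau>: "0 < \<tau>" and norm: "(\<integral>x. (\<tau> * f x + (q - p)) powr q \<partial>M) = (q - 1) powr q"
      using normalizing_scale_exists[OF L2 f(2) False, of q "q - p" "q - 1"] pq by auto
    have tf: "(\<lambda>x. \<tau> * f x) \<in> D" using f dom_scale by auto
    have nn: "AE x in M. 0 \<le> \<tau> * f x" using f(2) \<tau> by (auto elim!: eventually_mono)
    have "Psi M q (\<lambda>x. \<tau> * f x + (q - p)) \<le> ereal (C * E (\<lambda>x. \<tau> * f x + (q - p)) (\<lambda>x. \<tau> * f x + (q - p)))"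
      using nn pq by (intro Beckner form_add_const[OF cons tf]) (auto elim!: eventually_mono)
    also have "\<dots> = ereal (C * (\<tau>\<^sup>2 * E f f))"
      using form_add_const[OF cons tf, of "q - p"] form_scale_diag[OF f(1), of \<tau>] by simp
    finally have "Psi M p (\<lambda>x. \<tau> * f x) \<le> ereal (C * (\<tau>\<^sup>2 * E f f))"
      by (rule Psi_le_of_Psi_shift_le[OF subsetD[OF dom_L2 tf] nn pq norm])
    then have "ereal (\<tau>\<^sup>2) * Psi M p f \<le> ereal (\<tau>\<^sup>2) * ereal (C * E f f)"
      using Psi_scale[OF \<tau>, of p M f] pq by (simp add: mult.left_commute[of C])
    then show ?thesis
      using \<tau> ereal_mult_le_mult_iff[of "ereal (\<tau>\<^sup>2)" "Psi M p f" "ereal (C * E f f)"] by simp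
  qed
qed

theorem theorem1p2:
  fixes M :: "'a measure"
    and D :: "('a \<Rightarrow> real) set"
    and E :: "('a \<Rightarrow> real) \<Rightarrow> ('a \<Rightarrow> real) \<Rightarrow> real"
    and q C :: real
  assumes "prob_space M"
    and "symmetric_dirichlet_form M D E"
    and "conservative_form D E"
    and "1 \<le> q" and "q \<le> 2"
    and "\<forall>f\<in>D. (AE x in M. 0 \<le> f x) \<longrightarrow> Psi M q f \<le> ereal (C * E f f)"
  shows "\<forall>p. 1 \<le> p \<and> p \<le> q \<longrightarrow>
           (\<forall>f\<in>D. (AE x in M. 0 \<le> f x) \<longrightarrow> Psi M p f \<le> ereal (C * E f f))"
proof (intro allI impI ballI)
  fix p f assume p: "1 \<le> p \<and> p \<le> q" and f: "f \<in> D" "AE x in M. 0 \<le> f x"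
  interpret prob_space M by fact
  interpret symmetric_dirichlet_form M D E by fact
  have interior: "Psi M r f \<le> ereal (C * E f f)" if "1 < r" "r < q" for r
    using Beckner_inequality_downward[OF assms(1-3) that assms(5) _ f] assms(6) by blast
  consider "p = q" | "1 < p" "p < q" | "p = 1" "1 < q" using p by linarith
  then show "Psi M p f \<le> ereal (C * E f f)"
  proof cases
    case 1
    then show ?thesis using assms(6) f by auto
  next
    case 2
    then show ?thesis by (rule interior)
  next
    case 3
    then show ?thesis using Psi_1_le_of_Psi_le[of f q] f dom_L2 assms(5) interior by auto
  qed
qed

end
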